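(* Let $\eta=n\kappa^{1/2}$. If $Y$ satisfies the ODE $$\ddot Y+2n^{-1}\kappa^{-1/2}\dot Y+2n^{-2}\kappa^{-1}\nabla f(Y)=0,$$ then the energy $$E(t)=e^{n^{-1}\kappa^{-1/2}t}\left(f(Y(t))+\tfrac14\|Y(t)+\eta\dot Y(t)\|^2\right)$$ satisfies $E'(t)\le0$. This implies $E(t)\le E(0)$ for $t\ge0$, which is equivalent to $$f(Y(t))+\tfrac14\|Y(t)+n\kappa^{1/2}\dot Y(t)\|^2\le\left(f(Y(0))+\tfrac14\|Y(0)+\eta\dot Y(0)\|^2\right)e^{-n^{-1}\kappa^{-1/2}t}.$$
   Context: $f:\mathbb{R}^d\to\mathbb{R}$ is strongly convex with modulus $\sigma=1$ (after rescaling $f$) and has $L$-Lipschitz gradient, with variables split into $n$ coordinate blocks whose block Lipschitz constants satisfy $L_i=L$ for all $i$; $\kappa=L/\sigma=L$. The minimizer and minimum value are normalized: $x_*=0$, $f(x_* )=0$. *)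

theory Defs
  imports "HOL-Analysis.Analysis"
begin

definition strongly_convex :: "real \<Rightarrow> ('a::real_normed_vector \<Rightarrow> real) \<Rightarrow> bool" where
  "strongly_convex \<sigma> f \<longleftrightarrow> 0 < \<sigma> \<and>
     (\<forall>x y. \<forall>u\<in>{0..1}. f ((1 - u) *\<^sub>R x + u *\<^sub>R y)
        \<le> (1 - u) * f x + u * f y - \<sigma> / 2 * (u * (1 - u)) * (norm (x - y))\<^sup>2)"

definition coordinate_blocks :: "nat \<Rightarrow> (nat \<Rightarrow> 'd::finite set) \<Rightarrow> bool" where
  "coordinate_blocks n B \<longleftrightarrow>
     disjoint_family_on B {1..n} \<and> (\<Union>i\<in>{1..n}. B i) = UNIV \<and> (\<forall>i\<in>{1..n}. B i \<noteq> {})"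

(* A block component is kept in the ambient space and padded by zeros;
   its norm is the Euclidean norm of the block. *)
definition block_part :: "'d set \<Rightarrow> real ^ 'd::finite \<Rightarrow> real ^ 'd" where
  "block_part S x = (\<chi> j. if j \<in> S then x $ j else 0)"

(* For g the gradient of f: the block gradient with respect to S is C-Lipschitz
   along perturbations of the block S alone.  C need not be the least such constant. *)
definition block_lipschitz ::
    "real \<Rightarrow> 'd set \<Rightarrow> (real ^ 'd::finite \<Rightarrow> real ^ 'd) \<Rightarrow> bool" where
  "block_lipschitz C S g \<longleftrightarrow>
     (\<forall>x h. norm (block_part S (g (x + block_part S h)) - block_part S (g x))
              \<le> C * norm (block_part S h))"

end

theory Submission
  imports Defs
begin

text \<open>
  Write \<open>\<eta> = n \<surd>\<kappa>\<close> and \<open>g = \<nabla>f(Y)\<close>. In the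
  derivative of the squared norm, the equation of motion enters only through
  \<open>Y' + \<eta> Y'' = - Y' - (2/\<eta>) g\<close>. The coefficients are chosen so
  that all inner products \<open>Y \<bullet> Y'\<close> and \<open>g \<bullet> Y'\<close> cancel, leaving
  \<open>exp(-t/\<eta>) E'(t) = (f(Y) - g \<bullet> Y + |Y|^2/4)/\<eta> - \<eta> |Y'|^2/4\<close>.
  Strong convexity with modulus 1, read as a lower bound for
  \<open>0 = f(0)\<close> by the quadratic expansion of \<open>f\<close> at \<open>Y\<close>, gives
  \<open>f(Y) - g \<bullet> Y + |Y|^2/2 \<le> 0\<close>, so both terms are nonpositive.

  For this computation \<open>\<eta>\<close> has to be positive. There is at least one block because the
  blocks cover a nonempty index set, and \<open>L \<ge> 1\<close> because strong convexity makes
  the gradient expand distances at least by the factor 1, in a space with more than one point.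
  The energy decay is then the mean value theorem, and the final equivalence is
  multiplication by the positive number \<open>exp(t/\<eta>)\<close>.
\<close>

text \<open>
  Along the segment from \<open>x\<close> to \<open>y\<close>, the defining inequality bounds the difference quotient
  of \<open>f\<close> at \<open>x\<close> from above by \<open>f y - f x - \<sigma>/2 (1 - u) |x - y|^2\<close>;
  the claim is the limit \<open>u \<rightarrow> 0\<close>.
\<close>
lemma strongly_convex_gradient_bound:
  fixes f :: "'a::real_inner \<Rightarrow> real"
  assumes sc: "strongly_convex \<sigma> f" and g: "GDERIV f x :> g"
  shows "f x + g \<bullet> (y - x) + \<sigma> / 2 * (norm (y - x))\<^sup>2 \<le> f y"
proof -
  let ?c = "\<lambda>u::real. (1 - u) *\<^sub>R x + u *\<^sub>R y"
  have "(?c has_derivative (\<lambda>h. h *\<^sub>R (y - x))) (at 0)"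
    by (auto intro!: derivative_eq_intros simp: algebra_simps)
  moreover have "(f has_derivative (\<lambda>h. h \<bullet> g)) (at (?c 0))"
    using g by (simp add: gderiv_def)
  ultimately have "((\<lambda>u. f (?c u)) has_derivative (\<lambda>h. (h *\<^sub>R (y - x)) \<bullet> g)) (at 0)"
    by (rule has_derivative_compose)
  then have "((\<lambda>u. f (?c u)) has_real_derivative g \<bullet> (y - x)) (at 0)"
    by (rule has_derivative_imp_has_field_derivative) (simp add: inner_commute)
  then have lim: "((\<lambda>u. (f (?c u) - f x) / u) \<longlongrightarrow> g \<bullet> (y - x)) (at_right 0)"
    by (auto simp: has_field_derivative_iff intro: tendsto_mono at_le)
  have "((\<lambda>u. f y - f x - \<sigma> / 2 * (1 - u) * (norm (x - y))\<^sup>2)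
      \<longlongrightarrow> f y - f x - \<sigma> / 2 * (1 - 0) * (norm (x - y))\<^sup>2) (at_right 0)"
    by (intro tendsto_intros)
  moreover have "\<forall>\<^sub>F u in at_right 0.
      (f (?c u) - f x) / u \<le> f y - f x - \<sigma> / 2 * (1 - u) * (norm (x - y))\<^sup>2"
    using eventually_at_right_less[of 0] eventually_at_right_real[OF zero_less_one]
  proof eventually_elim
    case (elim u)
    then have "f (?c u) \<le> (1 - u) * f x + u * f y - \<sigma> / 2 * (u * (1 - u)) * (norm (x - y))\<^sup>2"
      using sc by (auto simp: strongly_convex_def)
    with elim show ?case
      by (simp add: field_simps)
  qed
  ultimately have "g \<bullet> (y - x) \<le> f y - f x - \<sigma> / 2 * (1 - 0) * (norm (x - y))\<^sup>2"
    using lim by (intro tendsto_le[OF _ _ lim]) auto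
  then show ?thesis
    by (simp add: norm_minus_commute)
qed

text \<open>
  Adding the gradient bounds at \<open>x\<close> and at \<open>y\<close> shows that the gradient is strongly monotone;
  by Cauchy-Schwarz it multiplies distances by at least \<open>\<sigma>\<close>.
\<close>
lemma strongly_convex_modulus_le_lipschitz:
  fixes f :: "'a::real_inner \<Rightarrow> real"
  assumes sc: "strongly_convex \<sigma> f" and g: "\<And>x. GDERIV f x :> g x"
    and lip: "L-lipschitz_on UNIV g" and xy: "(x::'a) \<noteq> y"
  shows "\<sigma> \<le> L"
proof -
  have "\<sigma> * (norm (y - x))\<^sup>2 \<le> (g y - g x) \<bullet> (y - x)"
    using strongly_convex_gradient_bound[OF sc g, of x y]
      strongly_convex_gradient_bound[OF sc g, of y x]
    by (simp add: norm_minus_commute[of x y] algebra_simps)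
  also have "\<dots> \<le> norm (g y - g x) * norm (y - x)"
    by (rule norm_cauchy_schwarz)
  also have "\<dots> \<le> L * norm (y - x) * norm (y - x)"
    using lipschitz_onD[OF lip, of y x] by (auto simp: dist_norm intro: mult_right_mono)
  finally have "\<sigma> * (norm (y - x))\<^sup>2 \<le> L * (norm (y - x))\<^sup>2"
    by (simp add: power2_eq_square algebra_simps)
  moreover have "0 < (norm (y - x))\<^sup>2"
    using xy by simp
  ultimately show ?thesis
    by (rule mult_right_le_imp_le)
qed

text \<open>
  The cancellation on which the choice of damping \<open>2/\<eta>\<close>, force coefficient
  \<open>2/\<eta>^2\<close> and weight \<open>1/4\<close> rests: the velocity
  \<open>v + \<eta> a\<close> of \<open>y + \<eta> v\<close> becomes \<open>- v - (2/\<eta>) g\<close>, whose \<open>g\<close>-part cancels the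
  change of potential \<open>g \<bullet> v\<close> and whose \<open>v\<close>-part cancels
  \<open>y \<bullet> v\<close> and leaves dissipation.
\<close>
lemma energy_derivative_identity:
  fixes y v a g :: "'a::real_inner"
  assumes \<eta>: "0 < \<eta>" and ode: "a + (2 / \<eta>) *\<^sub>R v + (2 / \<eta>\<^sup>2) *\<^sub>R g = 0"
  shows "(c + 1 / 4 * (norm (y + \<eta> *\<^sub>R v))\<^sup>2) / \<eta> + (g \<bullet> v + 1 / 2 * ((y + \<eta> *\<^sub>R v) \<bullet> (v + \<eta> *\<^sub>R a)))
    = (c - g \<bullet> y + 1 / 4 * (norm y)\<^sup>2) / \<eta> - \<eta> / 4 * (norm v)\<^sup>2"
proof -
  have "a = - ((2 / \<eta>) *\<^sub>R v + (2 / \<eta>\<^sup>2) *\<^sub>R g)"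
    using ode by (simp only: eq_neg_iff_add_eq_0 add.assoc)
  then have "\<eta> *\<^sub>R a = - (2 *\<^sub>R v) - (2 / \<eta>) *\<^sub>R g"
    using \<eta> by (simp add: scaleR_diff_right power2_eq_square)
  then have W: "v + \<eta> *\<^sub>R a = - v - (2 / \<eta>) *\<^sub>R g"
    by (simp add: scaleR_2)
  show ?thesis
    unfolding W
    using \<eta> by (simp add: power2_norm_eq_inner inner_add_left inner_add_right inner_diff_right
        inner_commute field_simps)
qed

lemma has_real_derivative_energy:
  fixes Y :: "real \<Rightarrow> 'a::real_inner"
  assumes g: "GDERIV f (Y t) :> g"
    and Y: "(Y has_vector_derivative v) (at t within S)"
    and V: "(V has_vector_derivative a) (at t within S)" and v: "V t = v"
  shows "((\<lambda>t. exp (t / \<eta>) * (f (Y t) + 1 / 4 * (norm (Y t + \<eta> *\<^sub>R V t))\<^sup>2)) has_real_derivative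
      exp (t / \<eta>) * ((f (Y t) + 1 / 4 * (norm (Y t + \<eta> *\<^sub>R v))\<^sup>2) / \<eta>
        + (g \<bullet> v + 1 / 2 * ((Y t + \<eta> *\<^sub>R v) \<bullet> (v + \<eta> *\<^sub>R a))))) (at t within S)"
proof -
  have "((\<lambda>s. f (Y s)) has_derivative (\<lambda>h. (h *\<^sub>R v) \<bullet> g)) (at t within S)"
    using has_derivative_compose[OF Y[unfolded has_vector_derivative_def] g[unfolded gderiv_def]] .
  then have f: "((\<lambda>s. f (Y s)) has_real_derivative g \<bullet> v) (at t within S)"
    by (rule has_derivative_imp_has_field_derivative) (simp add: inner_commute)
  have W: "((\<lambda>s. Y s + \<eta> *\<^sub>R V s) has_derivative (\<lambda>h. h *\<^sub>R (v + \<eta> *\<^sub>R a))) (at t within S)"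
    using Y V unfolding has_vector_derivative_def
    by (auto intro!: derivative_eq_intros simp: algebra_simps)
  have "((\<lambda>s. (Y s + \<eta> *\<^sub>R V s) \<bullet> (Y s + \<eta> *\<^sub>R V s)) has_real_derivative
      2 * ((Y t + \<eta> *\<^sub>R v) \<bullet> (v + \<eta> *\<^sub>R a))) (at t within S)"
    by (rule has_derivative_imp_has_field_derivative[OF has_derivative_inner[OF W W]])
      (simp add: v inner_commute)
  then have n: "((\<lambda>s. (norm (Y s + \<eta> *\<^sub>R V s))\<^sup>2) has_real_derivative
      2 * ((Y t + \<eta> *\<^sub>R v) \<bullet> (v + \<eta> *\<^sub>R a))) (at t within S)"
    by (simp add: power2_norm_eq_inner)
  have e: "((\<lambda>s. exp (s / \<eta>)) has_real_derivative exp (t / \<eta>) / \<eta>) (at t within S)"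
    using DERIV_chain2[OF DERIV_exp DERIV_cdivide[OF DERIV_ident, of \<eta> t S]] by simp
  show ?thesis
    by (rule DERIV_cong[OF DERIV_mult[OF e DERIV_add[OF f DERIV_cmult[OF n]]]])
      (simp add: v algebra_simps add_divide_distrib)
qed

lemma nonincreasing_on_half_line:
  fixes E :: "real \<Rightarrow> real"
  assumes D: "\<And>t. 0 \<le> t \<Longrightarrow> \<exists>E'. (E has_real_derivative E') (at t within {0..}) \<and> E' \<le> 0"
    and "0 \<le> t"
  shows "E t \<le> E 0"
proof (rule DERIV_nonpos_imp_decreasing_open[OF \<open>0 \<le> t\<close>])
  show "\<exists>y. (E has_real_derivative y) (at s) \<and> y \<le> 0" if "0 < s" for s
  proof -
    have "at s within {0..} = at s"
      using that by (intro at_within_interior) auto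
    then show ?thesis
      using D[of s] that by auto
  qed
  have "continuous_on {0..} E"
    using D DERIV_continuous by (fastforce simp: continuous_on_eq_continuous_within)
  then show "continuous_on {0..t} E"
    by (rule continuous_on_subset) auto
qed

lemma coordinate_blocks_count_pos:
  assumes "coordinate_blocks n (B :: nat \<Rightarrow> 'd::finite set)"
  shows "0 < n"
  using assms by (cases n) (auto simp: coordinate_blocks_def)

theorem lemma5:
  fixes f :: "real ^ 'd::finite \<Rightarrow> real"
    and gradf :: "real ^ 'd \<Rightarrow> real ^ 'd"
    and B :: "nat \<Rightarrow> 'd set"
    and Li :: "nat \<Rightarrow> real"
    and n :: nat
    and \<sigma> L \<kappa> \<eta> :: real
    and Y Y' Y'' :: "real \<Rightarrow> real ^ 'd"
    and E :: "real \<Rightarrow> real"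
  assumes gradient: "\<And>x. GDERIV f x :> gradf x"
    and strong: "strongly_convex \<sigma> f"
    and sigma: "\<sigma> = 1"
    and lipschitz: "L-lipschitz_on UNIV gradf"
    and blocks: "coordinate_blocks n B"
    and block_lip: "\<And>i. i \<in> {1..n} \<Longrightarrow> block_lipschitz (Li i) (B i) gradf"
    and equal_L: "\<And>i. i \<in> {1..n} \<Longrightarrow> Li i = L"
    and kappa: "\<kappa> = L / \<sigma>"
    and minimizer: "\<And>x. f 0 \<le> f x"
    and minimum: "f 0 = 0"
    and eta: "\<eta> = real n * sqrt \<kappa>"
    and Y': "\<And>t. 0 \<le> t \<Longrightarrow> (Y has_vector_derivative Y' t) (at t within {0..})"
    and Y'': "\<And>t. 0 \<le> t \<Longrightarrow> (Y' has_vector_derivative Y'' t) (at t within {0..})"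
    and ode: "\<And>t. 0 \<le> t \<Longrightarrow>
      Y'' t + (2 / (real n * sqrt \<kappa>)) *\<^sub>R Y' t + (2 / ((real n)\<^sup>2 * \<kappa>)) *\<^sub>R gradf (Y t) = 0"
    and energy: "\<And>t. E t =
      exp (t / (real n * sqrt \<kappa>)) * (f (Y t) + 1 / 4 * (norm (Y t + \<eta> *\<^sub>R Y' t))\<^sup>2)"
  shows "(\<forall>t\<ge>0. \<exists>E'. (E has_real_derivative E') (at t within {0..}) \<and> E' \<le> 0)
    \<and> (\<forall>t\<ge>0. E t \<le> E 0)
    \<and> (\<forall>t\<ge>0. E t \<le> E 0 \<longleftrightarrow>
          f (Y t) + 1 / 4 * (norm (Y t + (real n * sqrt \<kappa>) *\<^sub>R Y' t))\<^sup>2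
          \<le> (f (Y 0) + 1 / 4 * (norm (Y 0 + \<eta> *\<^sub>R Y' 0))\<^sup>2) * exp (- (t / (real n * sqrt \<kappa>))))"
proof -
  define c where "c = real n * sqrt \<kappa>"
  obtain e :: "real ^ 'd" where "0 \<noteq> e"
    using vector_choose_size[of 1] by (metis norm_zero zero_le_one zero_neq_one)
  then have "1 \<le> L"
    using strongly_convex_modulus_le_lipschitz[OF strong gradient lipschitz] sigma by simp
  with kappa sigma have "0 < \<kappa>"
    by simp
  with coordinate_blocks_count_pos[OF blocks] have c: "0 < c" "(real n)\<^sup>2 * \<kappa> = c\<^sup>2"
    by (auto simp: c_def power_mult_distrib)
  have E: "E = (\<lambda>t. exp (t / c) * (f (Y t) + 1 / 4 * (norm (Y t + c *\<^sub>R Y' t))\<^sup>2))"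
    using energy eta by (auto simp: c_def)
  have D: "\<exists>E'. (E has_real_derivative E') (at t within {0..}) \<and> E' \<le> 0" if t: "0 \<le> t" for t
  proof -
    have ode_t: "Y'' t + (2 / c) *\<^sub>R Y' t + (2 / c\<^sup>2) *\<^sub>R gradf (Y t) = 0"
      using ode[OF t] c by (simp add: c_def)
    have "f (Y t) + gradf (Y t) \<bullet> (0 - Y t) + \<sigma> / 2 * (norm (0 - Y t))\<^sup>2 \<le> f 0"
      by (rule strongly_convex_gradient_bound[OF strong gradient])
    then have "f (Y t) - gradf (Y t) \<bullet> Y t + 1 / 2 * (norm (Y t))\<^sup>2 \<le> 0"
      using minimum sigma by simp
    then have "f (Y t) - gradf (Y t) \<bullet> Y t + 1 / 4 * (norm (Y t))\<^sup>2 \<le> 0"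
      using zero_le_power2[of "norm (Y t)"] by linarith
    then have "(f (Y t) - gradf (Y t) \<bullet> Y t + 1 / 4 * (norm (Y t))\<^sup>2) / c
        - c / 4 * (norm (Y' t))\<^sup>2 \<le> 0"
      using c(1) divide_nonpos_pos[of _ c] mult_nonneg_nonneg[of "c / 4" "(norm (Y' t))\<^sup>2"]
      by (smt (verit) divide_nonneg_pos zero_le_power2)
    then show ?thesis
      using has_real_derivative_energy[OF gradient Y'[OF t] Y''[OF t] refl, of c]
      unfolding E energy_derivative_identity[OF c(1) ode_t]
      by (intro exI conjI) (auto simp: mult_le_0_iff)
  qed
  have decay: "E t \<le> E 0" if "0 \<le> t" for t
    by (rule nonincreasing_on_half_line[OF D that])
  have "E t \<le> E 0 \<longleftrightarrow>
      f (Y t) + 1 / 4 * (norm (Y t + (real n * sqrt \<kappa>) *\<^sub>R Y' t))\<^sup>2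
      \<le> (f (Y 0) + 1 / 4 * (norm (Y 0 + \<eta> *\<^sub>R Y' 0))\<^sup>2) * exp (- (t / (real n * sqrt \<kappa>)))" for t
    unfolding E eta c_def[symmetric] by (simp add: exp_minus field_simps)
  with D decay show ?thesis
    by blast
qed

end
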